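(* Let $\alpha>0$ and let $\mathbb{V}$ be the complexification of a real Hilbert space. Let $\widehat{f}\in H^2(\mathbb{C}_\alpha,\mathbb{V})$ with $f=\mathcal{L}^{-1}\{\widehat{f}\}\in L^2(\mathbb{R}_+,\mathbb{V})$, and let $\widehat{f}_\alpha$ be the boundary (limit) function of $\widehat f$ on the line $\operatorname{Re}(s)=\alpha$. Then $$\big\|\widehat{f}_\alpha\big\|_{L^2(i\mathbb{R},\mathbb{V})}=\sqrt{2}\,\big\|\operatorname{Re}\{\widehat{f}_\alpha\}\big\|_{L^2(i\mathbb{R},\mathbb{V})}.$$
   Context: $\mathbb{R}_+=\{t\in\mathbb{R}:t>0\}$ and $\mathbb{C}_\alpha=\{s\in\mathbb{C}:\operatorname{Re}(s)>\alpha\}$. The Laplace transform is $\mathcal{L}\{f\}(s)=\int_0^\infty e^{-st}f(t)\,dt$; $f=\mathcal{L}^{-1}\{\widehat f\}$ means $\mathcal{L}\{f\}=\widehat f$ on $\mathbb{C}_\alpha$. $H^2(\mathbb{C}_\alpha,\mathbb{V})$ is the space of holomorphic $\widehat f:\mathbb{C}_\alpha\to\mathbb{V}$ with $\sup_{\sigma>\alpha}\int_{-\infty}^{\infty}\|\widehat f(\sigma+i\tau)\|_{\mathbb{V}}^2\,d\tau<\infty$. Such a function has boundary values $\widehat f_\alpha(i\tau)=\lim_{\sigma\to\alpha^+}\widehat f(\sigma+i\tau)$ for almost every $\tau\in\mathbb{R}$, and $\widehat f_\alpha\in L^2(i\mathbb{R},\mathbb{V})$, where $\|h\|_{L^2(i\mathbb{R},\mathbb{V})}^2=\int_{-\infty}^\infty\|h(i\tau)\|_{\mathbb{V}}^2\,d\tau$.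 If $\mathbb{V}$ is the complexification of a real Hilbert space $\mathbb{V}_{\mathbb{R}}$, every $v\in\mathbb{V}$ is uniquely $v=a+ib$ with $a,b\in\mathbb{V}_{\mathbb{R}}$; $\operatorname{Re}\{v\}=a$, and $\|v\|_{\mathbb{V}}^2=\|a\|^2+\|b\|^2$. $\operatorname{Re}\{\widehat f_\alpha\}$ is taken pointwise. *)

theory Defs
  imports "HOL-Analysis.Analysis"
begin

text \<open>
  The complexification of a real vector space \<open>'v\<close> is modelled by \<open>'v \<times> 'v\<close>, the pair \<open>(a, b)\<close>
  standing for \<open>a + \<i> b\<close>. For \<open>'v :: {real_inner, banach}\<close> (a real Hilbert space, not necessarily
  separable) the library norm on pairs is already \<open>sqrt ((norm a)\<^sup>2 + (norm b)\<^sup>2)\<close>.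
\<close>

type_synonym 'v complexified = "'v \<times> 'v"

definition cscale :: "complex \<Rightarrow> 'v::real_vector complexified \<Rightarrow> 'v complexified" where
  "cscale z v = (Re z *\<^sub>R fst v - Im z *\<^sub>R snd v, Re z *\<^sub>R snd v + Im z *\<^sub>R fst v)"

definition Re_part :: "'v complexified \<Rightarrow> 'v" where
  "Re_part v = fst v"

lemma vector_space_cscale: "vector_space (cscale :: complex \<Rightarrow> 'v::real_vector complexified \<Rightarrow> _)"
  by unfold_locales (auto simp: cscale_def algebra_simps)

lemma complexified_decomp: "(a, b) = (a, 0) + cscale \<i> (b, 0)"
  by (simp add: cscale_def)

lemma norm_cscale:
  fixes v :: "'v::real_inner complexified"
  shows "norm (cscale z v) = norm z * norm v"
proof -
  have "(norm (cscale z v))\<^sup>2 = (norm z * norm v)\<^sup>2"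
    unfolding power_mult_distrib cmod_power2 unfolding power2_norm_eq_inner
    by (cases v) (simp add: cscale_def inner_diff_left inner_diff_right inner_add_left
      inner_add_right inner_commute power2_eq_square algebra_simps)
  then show ?thesis
    by (simp add: power2_eq_iff_nonneg)
qed

definition half_plane :: "real \<Rightarrow> complex set" where
  "half_plane \<alpha> = {s. Re s > \<alpha>}"

text \<open>Complex differentiability: the derivative is multiplication of a fixed vector by complex scalars.\<close>

definition cvec_holomorphic_on :: "(complex \<Rightarrow> 'v::real_normed_vector complexified) \<Rightarrow> complex set \<Rightarrow> bool" where
  "cvec_holomorphic_on F S \<longleftrightarrow>
     (\<forall>s\<in>S. \<exists>D. (F has_derivative (\<lambda>h. cscale h D)) (at s within S))"

definition hardy2 :: "real \<Rightarrow> (complex \<Rightarrow> 'v::real_normed_vector complexified) set" where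
  "hardy2 \<alpha> = {F. cvec_holomorphic_on F (half_plane \<alpha>) \<and>
     (SUP \<sigma>\<in>{\<alpha><..}. \<integral>\<^sup>+\<tau>. ennreal ((norm (F (Complex \<sigma> \<tau>)))\<^sup>2) \<partial>lebesgue) < \<infinity>}"

text \<open>
  Strong (Bochner) measurability. The library's Bochner integration requires a second countable
  target; almost everywhere limits of simple functions give the notion for an arbitrary target.
\<close>

definition strongly_measurable :: "'a measure \<Rightarrow> ('a \<Rightarrow> 'b::real_normed_vector) \<Rightarrow> bool" where
  "strongly_measurable M f \<longleftrightarrow>
     (\<exists>u :: nat \<Rightarrow> 'a \<Rightarrow> 'b. (\<forall>n. simple_function M (u n)) \<and> (AE x in M. (\<lambda>n. u n x) \<longlonglongrightarrow> f x))"

definition L2 :: "'a measure \<Rightarrow> ('a \<Rightarrow> 'b::real_normed_vector) set" where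
  "L2 M = {f. strongly_measurable M f \<and> (\<integral>\<^sup>+x. ennreal ((norm (f x))\<^sup>2) \<partial>M) < \<infinity>}"

definition L2_norm :: "'a measure \<Rightarrow> ('a \<Rightarrow> 'b::real_normed_vector) \<Rightarrow> real" where
  "L2_norm M f = sqrt (enn2real (\<integral>\<^sup>+x. ennreal ((norm (f x))\<^sup>2) \<partial>M))"

definition L2_imag_axis :: "(complex \<Rightarrow> 'b::real_normed_vector) set" where
  "L2_imag_axis = {h. (\<lambda>\<tau>. h (\<i> * complex_of_real \<tau>)) \<in> L2 lebesgue}"

definition L2_norm_imag_axis :: "(complex \<Rightarrow> 'b::real_normed_vector) \<Rightarrow> real" where
  "L2_norm_imag_axis h = L2_norm lebesgue (\<lambda>\<tau>. h (\<i> * complex_of_real \<tau>))"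

text \<open>
  The gauge integral is available for arbitrary Banach targets. It extends the Bochner integral,
  so for \<open>f \<in> L2 (lebesgue_on {0<..})\<close> and \<open>Re s > 0\<close>, where the integrand is Bochner integrable,
  both give the same value.
\<close>

definition has_laplace :: "(real \<Rightarrow> 'v::real_normed_vector complexified) \<Rightarrow> complex \<Rightarrow> 'v complexified \<Rightarrow> bool" where
  "has_laplace f s y \<longleftrightarrow>
     ((\<lambda>t. cscale (exp (- s * complex_of_real t)) (f t)) has_integral y) {0<..}"

definition is_boundary_function ::
  "real \<Rightarrow> (complex \<Rightarrow> 'v::real_normed_vector complexified) \<Rightarrow> (complex \<Rightarrow> 'v complexified) \<Rightarrow> bool" where
  "is_boundary_function \<alpha> F F\<alpha> \<longleftrightarrow>
     (AE \<tau> in lebesgue. ((\<lambda>\<sigma>. F (Complex \<sigma> \<tau>)) \<longlongrightarrow> F\<alpha> (\<i> * complex_of_real \<tau>)) (at_right \<alpha>))"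

end

theory Submission
  imports Defs "HOL-Complex_Analysis.Complex_Analysis" "HOL-Probability.Sinc_Integral"
begin

text \<open>
  Write \<open>F = a + \<i> b\<close> and extend the real inner product to a complex bilinear (not sesquilinear)
  form. Its square \<open>\<phi> = \<parallel>a\<parallel>\<^sup>2 - \<parallel>b\<parallel>\<^sup>2 + 2 \<i> \<langle>a, b\<rangle>\<close> is a scalar holomorphic function on the half plane,
  and \<open>\<bar>\<phi>\<bar> \<le> \<parallel>F\<parallel>\<^sup>2\<close>. The integral of \<open>\<phi>\<close> over the boundary line vanishes, because the contour can be
  pushed to the right where there are no singularities. The real part of this identity says that the
  real and imaginary parts of the boundary function have the same \<open>L\<^sup>2\<close> norm, and
  \<open>\<parallel>F\<parallel>\<^sup>2 = \<parallel>a\<parallel>\<^sup>2 + \<parallel>b\<parallel>\<^sup>2\<close> gives the factor \<open>sqrt 2\<close>.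

  Two points need care in pushing the contour. First, \<open>\<phi>\<close> is only integrable on the lines and has no
  decay rate, so it is multiplied by \<open>damping \<alpha> \<epsilon> s = 1 / (1 + \<epsilon> (s - \<alpha>))\<^sup>2\<close>, which is holomorphic, of modulus at
  most \<open>1\<close>, and tends to \<open>1\<close> as \<open>\<epsilon>\<close> tends to \<open>0\<close>. The damped function has integral zero on every line
  inside the half plane (\<open>vertical_line_integral_eq_0\<close>). Second, the boundary line is reached only as
  a limit. Since the inverse transform \<open>f\<close> lies in \<open>L\<^sup>2\<close> and \<open>\<alpha> > 0\<close>, the function \<open>F\<close> is bounded on the whole half plane
  (\<open>laplace_bounded\<close>), so dominated convergence takes the damped integral to the boundary. Removing the
  damping is then a second dominated convergence, with dominating function \<open>\<bar>\<phi>\<bar>\<close> on the boundary, whose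
  integrability is Fatou's lemma applied to the Hardy space bound. Both limits are in
  \<open>boundary_integral_eq_0\<close>.

  The space \<open>'v\<close> may be non-separable. Vector-valued Bochner integrals are therefore avoided: the
  vectors enter only through norms and the scalar function \<open>\<phi>\<close>, and strong measurability of the boundary
  function comes from explicit step functions (\<open>strongly_measurable_limit_of_continuous\<close>).
\<close>

section \<open>Integrals over vertical lines\<close>

lemma convex_half_plane: "convex (half_plane \<alpha>)"
  unfolding half_plane_def by (rule convex_halfspace_Re_gt)

lemma measurable_on_vertical_line:
  fixes g :: "complex \<Rightarrow> 'b::euclidean_space"
  assumes "continuous_on (half_plane \<alpha>) g" "\<sigma> > \<alpha>"
  shows "(\<lambda>\<tau>. g (Complex \<sigma> \<tau>)) \<in> borel_measurable lebesgue"
proof -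
  have "continuous_on UNIV (\<lambda>\<tau>. g (Complex \<sigma> \<tau>))"
    by (rule continuous_on_compose2[OF assms(1)])
       (use assms(2) in \<open>auto simp: half_plane_def Complex_eq intro!: continuous_intros\<close>)
  then have "(\<lambda>\<tau>. g (Complex \<sigma> \<tau>)) \<in> borel_measurable borel"
    by (rule borel_measurable_continuous_onI)
  then show ?thesis
    by (intro measurable_completion) auto
qed

text \<open>
  The segment is one side of a triangle whose two other sides have length of order \<open>R\<close> and stay at
  distance of order \<open>R\<close> from the midpoint \<open>\<sigma>\<close> of the segment. The integrand is of order \<open>1 / R\<^sup>2\<close> there,
  and Cauchy's theorem transfers the bound to the segment.
\<close>

lemma norm_integral_segment_le:
  fixes \<psi> :: "complex \<Rightarrow> complex"
  assumes hol: "\<psi> holomorphic_on half_plane \<alpha>" and \<sigma>: "\<sigma> > \<alpha>" and R: "R > 0"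
    and decay: "\<And>s. Re s \<ge> \<sigma> \<Longrightarrow> norm (\<psi> s) * (norm (s - of_real \<sigma>))\<^sup>2 \<le> K"
  shows "norm (integral {-R..R} (\<lambda>\<tau>. \<psi> (Complex \<sigma> \<tau>))) \<le> 8 * K / R"
proof -
  define a b c where "a = Complex \<sigma> (-R)" "b = Complex \<sigma> R" "c = Complex (\<sigma> + R) 0"
  note abc = this
  have "0 \<le> K"
    using decay[of "of_real \<sigma>"] by simp
  have sub: "convex hull {a, b, c} \<subseteq> half_plane \<alpha>"
    by (rule hull_minimal) (use \<sigma> R convex_half_plane in \<open>auto simp: half_plane_def abc\<close>)
  have "(\<psi> has_contour_integral 0) (linepath a b +++ linepath b c +++ linepath c a)"
    by (rule Cauchy_theorem_triangle) (rule holomorphic_on_subset[OF hol sub])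
  then have zero: "contour_integral (linepath a b +++ linepath b c +++ linepath c a) \<psi> = 0"
    by (rule contour_integral_unique)
  have seg: "\<psi> contour_integrable_on linepath p q" if "p \<in> {a, b, c}" "q \<in> {a, b, c}" for p q
  proof (rule contour_integrable_continuous_linepath)
    have "closed_segment p q \<subseteq> convex hull {a, b, c}"
      using that by (intro closed_segment_subset_convex_hull) (auto intro: hull_inc)
    then show "continuous_on (closed_segment p q) \<psi>"
      using hol sub by (meson continuous_on_subset holomorphic_on_imp_continuous_on subset_trans)
  qed
  define I1 I2 I3 where "I1 = contour_integral (linepath a b) \<psi>"
    "I2 = contour_integral (linepath b c) \<psi>" "I3 = contour_integral (linepath c a) \<psi>"
  note I_def = this
  have I: "(\<psi> has_contour_integral I1) (linepath a b)"
      "(\<psi> has_contour_integral I2) (linepath b c)" "(\<psi> has_contour_integral I3) (linepath c a)"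
    unfolding I_def by (intro has_contour_integral_integral seg; simp)+
  have I_sum: "I1 + (I2 + I3) = 0"
    using zero seg by (simp add: I_def)
  \<comment> \<open>Points of the two slanted sides are \<open>\<sigma> + u R \<plusminus> \<i> (1 - u) R\<close>; the distance to \<open>\<sigma>\<close> is least at \<open>u = 1 / 2\<close>.\<close>
  have far: "norm (\<psi> s) \<le> 2 * K / R\<^sup>2" if s: "Re s = \<sigma> + u * R" "\<bar>Im s\<bar> = (1 - u) * R" "0 \<le> u" for s u
  proof -
    have "(norm (s - of_real \<sigma>))\<^sup>2 = (u * R)\<^sup>2 + \<bar>Im s\<bar>\<^sup>2"
      unfolding cmod_power2 by (simp add: s(1))
    also have "\<dots> = R\<^sup>2 / 2 + (R * (2 * u - 1))\<^sup>2 / 2"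
      unfolding s(2) by (simp add: power2_eq_square field_simps)
    finally have "R\<^sup>2 / 2 \<le> (norm (s - of_real \<sigma>))\<^sup>2"
      by simp
    then have "norm (\<psi> s) * (R\<^sup>2 / 2) \<le> norm (\<psi> s) * (norm (s - of_real \<sigma>))\<^sup>2"
      by (rule mult_left_mono) simp
    also have "\<dots> \<le> K"
      by (rule decay) (use s R in auto)
    finally show ?thesis
      using R by (simp add: field_simps)
  qed
  have len: "norm (b - c) \<le> 2 * R" "norm (a - c) \<le> 2 * R"
    using R cmod_le[of "b - c"] cmod_le[of "a - c"] by (auto simp: abc)
  have side: "norm J \<le> 4 * K / R"
    if J: "(\<psi> has_contour_integral J) (linepath p q)" "norm (q - p) \<le> 2 * R"
      and seg: "\<And>s. s \<in> closed_segment p q \<Longrightarrow> \<exists>u\<ge>0. Re s = \<sigma> + u * R \<and> \<bar>Im s\<bar> = (1 - u) * R"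
    for J p q
  proof -
    have "norm J \<le> (2 * K / R\<^sup>2) * norm (q - p)"
    proof (rule has_contour_integral_bound_linepath[OF J(1)])
      show "0 \<le> 2 * K / R\<^sup>2" using \<open>0 \<le> K\<close> by simp
      show "norm (\<psi> s) \<le> 2 * K / R\<^sup>2" if "s \<in> closed_segment p q" for s
        using seg[OF that] far by blast
    qed
    also have "\<dots> \<le> (2 * K / R\<^sup>2) * (2 * R)"
      by (rule mult_left_mono[OF J(2)]) (use \<open>0 \<le> K\<close> in auto)
    also have "\<dots> = 4 * K / R"
      using R by (simp add: power2_eq_square field_simps)
    finally show ?thesis .
  qed
  have "norm I2 \<le> 4 * K / R"
  proof (rule side[OF I(2)])
    show "\<exists>u\<ge>0. Re s = \<sigma> + u * R \<and> \<bar>Im s\<bar> = (1 - u) * R" if s: "s \<in> closed_segment b c" for s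
    proof -
      obtain u where u: "0 \<le> u" "u \<le> 1" "s = (1 - u) *\<^sub>R b + u *\<^sub>R c"
        using s unfolding in_segment by blast
      have "Re s = \<sigma> + u * R" "Im s = (1 - u) * R"
        unfolding u(3) abc by (simp_all add: algebra_simps)
      moreover have "\<bar>(1 - u) * R\<bar> = (1 - u) * R"
        using u R by simp
      ultimately show ?thesis
        using u(1) by metis
    qed
  qed (use len in \<open>simp add: norm_minus_commute\<close>)
  moreover have "norm I3 \<le> 4 * K / R"
  proof (rule side[OF I(3)])
    show "\<exists>u\<ge>0. Re s = \<sigma> + u * R \<and> \<bar>Im s\<bar> = (1 - u) * R" if s: "s \<in> closed_segment c a" for s
    proof -
      obtain u where u: "0 \<le> u" "u \<le> 1" "s = (1 - u) *\<^sub>R c + u *\<^sub>R a"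
        using s unfolding in_segment by blast
      have "Re s = \<sigma> + (1 - u) * R" "Im s = - ((1 - (1 - u)) * R)"
        unfolding u(3) abc by (simp_all add: algebra_simps)
      moreover have "\<bar>- ((1 - (1 - u)) * R)\<bar> = (1 - (1 - u)) * R"
        using u R by simp
      moreover have "0 \<le> 1 - u"
        using u by simp
      ultimately show ?thesis
        by metis
    qed
  qed (use len in simp)
  moreover have "norm I1 = norm (I2 + I3)"
    using I_sum by (metis add_eq_0_iff norm_minus_cancel)
  moreover have "8 * K / R = 4 * K / R + 4 * K / R"
    by simp
  ultimately have "norm I1 \<le> 8 * K / R"
    using norm_triangle_ineq[of I2 I3] by linarith
  moreover have "((\<lambda>\<tau>. \<psi> (Complex \<sigma> \<tau>)) has_integral (-\<i> * I1)) {-R..R}"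
    using has_contour_integral_linepath_same_Re_iff[of a \<sigma> b "-R" R \<psi> I1] I(1) R
    by (simp add: abc)
  ultimately show ?thesis
    by (simp add: integral_unique norm_mult)
qed

lemma vertical_line_integral_eq_0:
  fixes \<psi> :: "complex \<Rightarrow> complex"
  assumes hol: "\<psi> holomorphic_on half_plane \<alpha>" and \<sigma>: "\<sigma> > \<alpha>"
    and int: "integrable lebesgue (\<lambda>\<tau>. \<psi> (Complex \<sigma> \<tau>))"
    and decay: "\<And>s. Re s \<ge> \<sigma> \<Longrightarrow> norm (\<psi> s) * (norm (s - of_real \<sigma>))\<^sup>2 \<le> K"
  shows "(\<integral>\<tau>. \<psi> (Complex \<sigma> \<tau>) \<partial>lebesgue) = 0"
proof -
  let ?g = "\<lambda>\<tau>. \<psi> (Complex \<sigma> \<tau>)"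
  define J where "J n = (LINT \<tau>:{-real (Suc n)..real (Suc n)}|lebesgue. ?g \<tau>)" for n
  have "J \<longlonglongrightarrow> (\<integral>\<tau>. ?g \<tau> \<partial>lebesgue)"
    unfolding J_def set_lebesgue_integral_def
  proof (rule integral_dominated_convergence[where w = "\<lambda>\<tau>. norm (?g \<tau>)"])
    show "AE \<tau> in lebesgue. (\<lambda>n. indicat_real {- real (Suc n)..real (Suc n)} \<tau> *\<^sub>R ?g \<tau>) \<longlonglongrightarrow> ?g \<tau>"
    proof (intro AE_I2 tendsto_eventually)
      fix \<tau> :: real
      show "\<forall>\<^sub>F n in sequentially. indicat_real {- real (Suc n)..real (Suc n)} \<tau> *\<^sub>R ?g \<tau> = ?g \<tau>"
        using eventually_ge_at_top[of "nat \<lceil>\<bar>\<tau>\<bar>\<rceil>"]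
      proof eventually_elim
        case (elim n)
        then have "\<bar>\<tau>\<bar> \<le> real (Suc n)" by linarith
        then show ?case by (auto simp: abs_le_iff)
      qed
    qed
  next
    show "(\<lambda>\<tau>. indicat_real {- real (Suc n)..real (Suc n)} \<tau> *\<^sub>R ?g \<tau>) \<in> borel_measurable lebesgue" for n
      using int by (intro borel_measurable_scaleR borel_measurable_indicator) auto
  qed (use int in \<open>auto simp: indicator_def\<close>)
  moreover have "J \<longlonglongrightarrow> 0"
  proof (rule Lim_null_comparison)
    show "\<forall>\<^sub>F n in sequentially. norm (J n) \<le> 8 * K / real (Suc n)"
    proof (intro always_eventually allI)
      fix n
      have "set_integrable lebesgue {-real (Suc n)..real (Suc n)} ?g"
        unfolding set_integrable_def by (rule integrable_mult_indicator[OF _ int]) auto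
      then show "norm (J n) \<le> 8 * K / real (Suc n)"
        unfolding J_def using norm_integral_segment_le[OF hol \<sigma> _ decay, of "real (Suc n)"]
        by (simp add: set_lebesgue_integral_eq_integral del: of_nat_Suc)
    qed
    show "(\<lambda>n. 8 * K / real (Suc n)) \<longlonglongrightarrow> 0"
      using tendsto_mult_right_zero[OF LIMSEQ_inverse_real_of_nat, of "8 * K"]
      by (simp add: divide_inverse)
  qed
  ultimately show ?thesis
    using LIMSEQ_unique by blast
qed

section \<open>Passage to the boundary line\<close>

text \<open>
  The second power makes the factor integrable on vertical lines, and the shift by \<open>\<alpha>\<close> bounds it by
  \<open>1 / (1 + (\<epsilon> Im s)\<^sup>2)\<close> on the closed half plane, uniformly in the real part.
\<close>

definition damping :: "real \<Rightarrow> real \<Rightarrow> complex \<Rightarrow> complex" where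
  "damping \<alpha> \<epsilon> s = inverse ((1 + of_real \<epsilon> * (s - of_real \<alpha>))\<^sup>2)"

lemma norm_damping:
  "norm (damping \<alpha> \<epsilon> s) = inverse ((1 + \<epsilon> * (Re s - \<alpha>))\<^sup>2 + (\<epsilon> * Im s)\<^sup>2)"
proof -
  have "norm (damping \<alpha> \<epsilon> s) = inverse ((norm (1 + of_real \<epsilon> * (s - of_real \<alpha>)))\<^sup>2)"
    by (simp add: damping_def norm_inverse norm_power)
  then show ?thesis
    unfolding cmod_power2 by simp
qed

lemma damping_denominator_nonzero:
  assumes "\<epsilon> \<ge> 0" "Re s \<ge> \<alpha>"
  shows "1 + of_real \<epsilon> * (s - of_real \<alpha>) \<noteq> 0"
proof
  assume "1 + of_real \<epsilon> * (s - of_real \<alpha>) = 0"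
  then have "Re (1 + of_real \<epsilon> * (s - of_real \<alpha>)) = 0"
    by simp
  then have "1 + \<epsilon> * (Re s - \<alpha>) = 0" by simp
  moreover have "0 \<le> \<epsilon> * (Re s - \<alpha>)" using assms by simp
  ultimately show False by linarith
qed

lemma norm_damping_le:
  assumes "\<epsilon> \<ge> 0" "Re s \<ge> \<alpha>"
  shows "norm (damping \<alpha> \<epsilon> s) \<le> inverse (1 + (\<epsilon> * Im s)\<^sup>2)"
proof -
  have "1\<^sup>2 \<le> (1 + \<epsilon> * (Re s - \<alpha>))\<^sup>2"
    by (rule power_mono) (use assms in auto)
  moreover have "0 \<le> (\<epsilon> * Im s)\<^sup>2" by simp
  ultimately show ?thesis
    unfolding norm_damping by (intro le_imp_inverse_le) (auto intro: add_pos_nonneg)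
qed

lemma measurable_damping:
  assumes "\<epsilon> \<ge> 0"
  shows "(\<lambda>\<tau>. damping \<alpha> \<epsilon> (Complex \<alpha> \<tau>)) \<in> borel_measurable lebesgue"
proof -
  have "1 + of_real \<epsilon> * (Complex \<alpha> \<tau> - of_real \<alpha>) \<noteq> 0" for \<tau>
    using damping_denominator_nonzero[of \<epsilon> \<alpha> "Complex \<alpha> \<tau>"] assms by simp
  then have "continuous_on UNIV (\<lambda>\<tau>. damping \<alpha> \<epsilon> (Complex \<alpha> \<tau>))"
    unfolding damping_def Complex_eq by (intro continuous_intros) auto
  then show ?thesis
    by (intro measurable_completion) (simp add: borel_measurable_continuous_onI)
qed

lemma integrable_inverse_1_plus_scaled_square:
  assumes "\<epsilon> > (0::real)"
  shows "integrable lebesgue (\<lambda>\<tau>. inverse (1 + (\<epsilon> * \<tau>)\<^sup>2))"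
proof -
  have "integrable lborel (\<lambda>x::real. inverse (1 + x\<^sup>2))"
    using integrable_inverse_1_plus_square by (simp add: set_integrable_def)
  from lborel_integrable_real_affine[OF this, of \<epsilon> 0] assms
  have "integrable lborel (\<lambda>\<tau>. inverse (1 + (\<epsilon> * \<tau>)\<^sup>2))" by simp
  then show ?thesis
    by (subst integrable_completion) auto
qed

text \<open>
  For fixed \<open>\<epsilon>\<close> the damped function is dominated on all lines by one integrable function because \<open>\<phi>\<close> is
  bounded; this allows \<open>\<sigma>\<close> to tend to \<open>\<alpha>\<close>. The integrability of \<open>g\<close> then allows \<open>\<epsilon>\<close> to tend to \<open>0\<close>.
\<close>

lemma boundary_integral_eq_0:
  fixes \<phi> :: "complex \<Rightarrow> complex"
  assumes hol: "\<phi> holomorphic_on half_plane \<alpha>"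
    and bound: "\<And>s. s \<in> half_plane \<alpha> \<Longrightarrow> norm (\<phi> s) \<le> K"
    and int: "integrable lebesgue g"
    and lim: "AE \<tau> in lebesgue. ((\<lambda>\<sigma>. \<phi> (Complex \<sigma> \<tau>)) \<longlongrightarrow> g \<tau>) (at_right \<alpha>)"
  shows "(\<integral>\<tau>. g \<tau> \<partial>lebesgue) = 0"
proof -
  define \<sigma> where "\<sigma> n = \<alpha> + inverse (real (Suc n))" for n
  have \<sigma>: "\<sigma> n > \<alpha>" for n by (simp add: \<sigma>_def)
  have \<sigma>_lim: "\<sigma> \<longlonglongrightarrow> \<alpha>"
    unfolding \<sigma>_def using LIMSEQ_inverse_real_of_nat_add by blast
  have \<sigma>_right: "filterlim \<sigma> (at_right \<alpha>) sequentially"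
    using \<sigma> \<sigma>_lim by (auto simp: filterlim_at intro!: always_eventually)
  have "0 \<le> K"
    using order_trans[OF norm_ge_zero bound[of "Complex (\<sigma> 0) 0"]] \<sigma>[of 0]
    by (simp add: half_plane_def)
  let ?B = "\<lambda>\<tau>. Complex \<alpha> \<tau>"
  have damped: "(\<integral>\<tau>. g \<tau> * damping \<alpha> \<epsilon> (?B \<tau>) \<partial>lebesgue) = 0" if \<epsilon>: "\<epsilon> > 0" for \<epsilon>
  proof -
    define \<psi> where "\<psi> s = \<phi> s * damping \<alpha> \<epsilon> s" for s
    have hol_d: "damping \<alpha> \<epsilon> holomorphic_on half_plane \<alpha>"
      unfolding damping_def
      by (intro holomorphic_intros)
         (use damping_denominator_nonzero[of \<epsilon>] \<epsilon> in \<open>auto simp: half_plane_def\<close>)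
    have hol_\<psi>: "\<psi> holomorphic_on half_plane \<alpha>"
      unfolding \<psi>_def by (intro holomorphic_intros hol hol_d)
    have dom: "norm (\<psi> (Complex (\<sigma> n) \<tau>)) \<le> K * inverse (1 + (\<epsilon> * \<tau>)\<^sup>2)" for n \<tau>
      unfolding \<psi>_def norm_mult
      using bound[of "Complex (\<sigma> n) \<tau>"] norm_damping_le[of \<epsilon> \<alpha> "Complex (\<sigma> n) \<tau>"] \<epsilon> \<sigma>[of n] \<open>0 \<le> K\<close>
      by (intro mult_mono) (auto simp: half_plane_def)
    have dom_int: "integrable lebesgue (\<lambda>\<tau>. K * inverse (1 + (\<epsilon> * \<tau>)\<^sup>2))"
      using integrable_inverse_1_plus_scaled_square[OF \<epsilon>] by simp
    have meas: "(\<lambda>\<tau>. \<psi> (Complex (\<sigma> n) \<tau>)) \<in> borel_measurable lebesgue" for n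
      using measurable_on_vertical_line[OF holomorphic_on_imp_continuous_on[OF hol_\<psi>] \<sigma>] .
    have zero: "(\<integral>\<tau>. \<psi> (Complex (\<sigma> n) \<tau>) \<partial>lebesgue) = 0" for n
    proof (rule vertical_line_integral_eq_0[OF hol_\<psi> \<sigma>])
      show "integrable lebesgue (\<lambda>\<tau>. \<psi> (Complex (\<sigma> n) \<tau>))"
        by (rule Bochner_Integration.integrable_bound[OF dom_int meas]) (use dom \<open>0 \<le> K\<close> in auto)
      fix s assume s: "Re s \<ge> \<sigma> n"
      \<comment> \<open>\<open>N = \<bar>1 + \<epsilon> (s - \<alpha>)\<bar>\<^sup>2\<close>, which dominates \<open>\<epsilon>\<^sup>2 \<bar>s - \<sigma> n\<bar>\<^sup>2\<close> since \<open>Re s \<ge> \<sigma> n > \<alpha>\<close>.\<close>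
      define N where "N = (1 + \<epsilon> * (Re s - \<alpha>))\<^sup>2 + (\<epsilon> * Im s)\<^sup>2"
      have e: "0 \<le> \<epsilon> * (Re s - \<sigma> n)" "\<epsilon> * \<sigma> n > \<epsilon> * \<alpha>"
        using \<epsilon> s \<sigma>[of n] by auto
      have "(\<epsilon> * norm (s - of_real (\<sigma> n)))\<^sup>2 = (\<epsilon> * (Re s - \<sigma> n))\<^sup>2 + (\<epsilon> * Im s)\<^sup>2"
        unfolding power_mult_distrib cmod_power2 by (simp add: algebra_simps)
      also have "\<dots> \<le> N"
        unfolding N_def using e by (intro add_right_mono power_mono) (auto simp: algebra_simps)
      finally have le: "\<epsilon>\<^sup>2 * (norm (s - of_real (\<sigma> n)))\<^sup>2 \<le> N"
        by (simp add: power_mult_distrib)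
      have "0 < 1 + \<epsilon> * (Re s - \<alpha>)"
        using e by (simp add: algebra_simps)
      then have "N > 0"
        unfolding N_def by (simp add: add_pos_nonneg)
      have nd: "norm (damping \<alpha> \<epsilon> s) * (norm (s - of_real (\<sigma> n)))\<^sup>2 \<le> 1 / \<epsilon>\<^sup>2"
        using le \<open>N > 0\<close> \<epsilon> unfolding norm_damping N_def[symmetric]
        by (simp add: field_simps)
      have "norm (\<psi> s) * (norm (s - of_real (\<sigma> n)))\<^sup>2
          = norm (\<phi> s) * (norm (damping \<alpha> \<epsilon> s) * (norm (s - of_real (\<sigma> n)))\<^sup>2)"
        by (simp add: \<psi>_def norm_mult)
      also have "\<dots> \<le> K * (1 / \<epsilon>\<^sup>2)"
        using bound[of s] s \<sigma>[of n] nd \<open>0 \<le> K\<close> by (intro mult_mono) (auto simp: half_plane_def)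
      finally show "norm (\<psi> s) * (norm (s - of_real (\<sigma> n)))\<^sup>2 \<le> K * (1 / \<epsilon>\<^sup>2)" .
    qed
    have "(\<lambda>n. \<integral>\<tau>. \<psi> (Complex (\<sigma> n) \<tau>) \<partial>lebesgue)
        \<longlonglongrightarrow> (\<integral>\<tau>. g \<tau> * damping \<alpha> \<epsilon> (?B \<tau>) \<partial>lebesgue)"
    proof (rule integral_dominated_convergence[OF _ meas dom_int])
      show "AE \<tau> in lebesgue. (\<lambda>n. \<psi> (Complex (\<sigma> n) \<tau>)) \<longlonglongrightarrow> g \<tau> * damping \<alpha> \<epsilon> (?B \<tau>)"
        using lim
      proof eventually_elim
        case (elim \<tau>)
        have "(\<lambda>n. damping \<alpha> \<epsilon> (Complex (\<sigma> n) \<tau>)) \<longlonglongrightarrow> damping \<alpha> \<epsilon> (?B \<tau>)"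
          unfolding damping_def Complex_eq
          by (intro tendsto_intros \<sigma>_lim) (use damping_denominator_nonzero[of \<epsilon> \<alpha> "?B \<tau>"] \<epsilon> in \<open>auto simp: Complex_eq\<close>)
        then show ?case
          unfolding \<psi>_def
          by (intro tendsto_mult filterlim_compose[OF elim \<sigma>_right])
      qed
      show "(\<lambda>\<tau>. g \<tau> * damping \<alpha> \<epsilon> (?B \<tau>)) \<in> borel_measurable lebesgue"
        using int \<epsilon> by (intro borel_measurable_times measurable_damping) auto
    qed (use dom in auto)
    then show ?thesis
      unfolding zero using LIMSEQ_unique tendsto_const by blast
  qed
  define \<epsilon> where "\<epsilon> n = inverse (real (Suc n))" for n
  have \<epsilon>_pos: "\<epsilon> n > 0" for n by (simp add: \<epsilon>_def)
  have \<epsilon>_lim: "\<epsilon> \<longlonglongrightarrow> 0"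
    unfolding \<epsilon>_def by (rule LIMSEQ_inverse_real_of_nat)
  have "(\<lambda>n. \<integral>\<tau>. g \<tau> * damping \<alpha> (\<epsilon> n) (?B \<tau>) \<partial>lebesgue) \<longlonglongrightarrow> (\<integral>\<tau>. g \<tau> \<partial>lebesgue)"
  proof (rule integral_dominated_convergence[where w = "\<lambda>\<tau>. norm (g \<tau>)"])
    show "AE \<tau> in lebesgue. (\<lambda>n. g \<tau> * damping \<alpha> (\<epsilon> n) (?B \<tau>)) \<longlonglongrightarrow> g \<tau>"
    proof (rule AE_I2)
      fix \<tau>
      have "(\<lambda>n. g \<tau> * damping \<alpha> (\<epsilon> n) (?B \<tau>)) \<longlonglongrightarrow> g \<tau> * inverse ((1 + of_real 0 * (?B \<tau> - of_real \<alpha>))\<^sup>2)"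
        unfolding damping_def by (intro tendsto_intros \<epsilon>_lim) auto
      then show "(\<lambda>n. g \<tau> * damping \<alpha> (\<epsilon> n) (?B \<tau>)) \<longlonglongrightarrow> g \<tau>" by simp
    qed
    show "(\<lambda>\<tau>. g \<tau> * damping \<alpha> (\<epsilon> n) (?B \<tau>)) \<in> borel_measurable lebesgue" for n
      using int \<epsilon>_pos[of n] by (intro borel_measurable_times measurable_damping) auto
    show "AE \<tau> in lebesgue. norm (g \<tau> * damping \<alpha> (\<epsilon> n) (?B \<tau>)) \<le> norm (g \<tau>)" for n
    proof (rule AE_I2)
      fix \<tau>
      have "norm (damping \<alpha> (\<epsilon> n) (?B \<tau>)) \<le> inverse (1 + (\<epsilon> n * \<tau>)\<^sup>2)"
        using norm_damping_le[of "\<epsilon> n" \<alpha> "?B \<tau>"] \<epsilon>_pos[of n] by simp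
      also have "\<dots> \<le> 1"
        by (rule inverse_le_1_iff[THEN iffD2]) simp
      finally show "norm (g \<tau> * damping \<alpha> (\<epsilon> n) (?B \<tau>)) \<le> norm (g \<tau>)"
        by (simp add: norm_mult mult_left_le)
    qed
  qed (use int in auto)
  then show ?thesis
    unfolding damped[OF \<epsilon>_pos] using LIMSEQ_unique tendsto_const by blast
qed

section \<open>The complex bilinear square\<close>

text \<open>
  The value \<open>B v v\<close> for the complex bilinear extension \<open>B\<close> of the inner product. Bilinearity, in place of
  the sesquilinear Hermitian product, is what preserves holomorphy.
\<close>

definition bilinear_square :: "'v::real_inner complexified \<Rightarrow> complex" where
  "bilinear_square v = Complex ((norm (fst v))\<^sup>2 - (norm (snd v))\<^sup>2) (2 * inner (fst v) (snd v))"

lemma norm_complexified_power2: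
  fixes v :: "'v::real_inner complexified"
  shows "(norm v)\<^sup>2 = (norm (fst v))\<^sup>2 + (norm (snd v))\<^sup>2"
  by (simp add: norm_prod_def)

lemma norm_bilinear_square_le: "norm (bilinear_square v) \<le> (norm v)\<^sup>2"
proof -
  define x y where "x = norm (fst v)" "y = norm (snd v)"
  have "(inner (fst v) (snd v))\<^sup>2 \<le> (x * y)\<^sup>2"
    unfolding x_y_def using Cauchy_Schwarz_ineq2[of "fst v" "snd v"]
    by (metis abs_ge_zero power2_abs power_mono)
  then have "(norm (bilinear_square v))\<^sup>2 \<le> (x\<^sup>2 + y\<^sup>2)\<^sup>2"
    unfolding cmod_power2 bilinear_square_def x_y_def[symmetric]
    by (simp add: power2_eq_square algebra_simps)
  then show ?thesis
    unfolding norm_complexified_power2 x_y_def[symmetric]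
    by (rule power2_le_imp_le) simp
qed

lemma tendsto_bilinear_square:
  "(g \<longlongrightarrow> v) G \<Longrightarrow> ((\<lambda>x. bilinear_square (g x)) \<longlongrightarrow> bilinear_square v) G"
  unfolding bilinear_square_def by (intro tendsto_intros)

text \<open>
  The derivative is \<open>2 B (F s) D\<close>, where \<open>D\<close> is the derivative of \<open>F\<close> and \<open>B\<close> is complex bilinear.
\<close>

lemma holomorphic_on_bilinear_square:
  assumes "cvec_holomorphic_on F S"
  shows "(\<lambda>s. bilinear_square (F s)) holomorphic_on S"
  unfolding holomorphic_on_def field_differentiable_def
proof
  fix s assume "s \<in> S"
  then obtain D where D: "(F has_derivative (\<lambda>h. cscale h D)) (at s within S)"
    using assms unfolding cvec_holomorphic_on_def by blast
  let ?c = "2 * Complex (inner (fst (F s)) (fst D) - inner (snd (F s)) (snd D))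
                 (inner (fst D) (snd (F s)) + inner (fst (F s)) (snd D))"
  have eq: "bilinear_square v = of_real (inner (fst v) (fst v) - inner (snd v) (snd v))
      + \<i> * of_real (2 * inner (fst v) (snd v))" for v :: "'a complexified"
    by (simp add: bilinear_square_def Complex_eq power2_norm_eq_inner)
  have "((\<lambda>s. bilinear_square (F s)) has_derivative (*) ?c) (at s within S)"
    unfolding eq
    by (rule derivative_eq_intros D has_derivative_of_real refl)+
       (auto simp: fun_eq_iff complex_eq_iff cscale_def inner_diff_left inner_diff_right
         inner_add_left inner_add_right inner_commute algebra_simps)
  then show "\<exists>f'. ((\<lambda>s. bilinear_square (F s)) has_field_derivative f') (at s within S)"
    unfolding has_field_derivative_def by blast
qed

section \<open>Laplace transforms\<close>

text \<open>
  The limit holds only almost everywhere, so completeness of Lebesgue measure is used; the function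
  is extended by \<open>0\<close> outside \<open>S\<close> to work with the measure on the whole line.
\<close>

lemma strongly_measurable_norm:
  fixes f :: "real \<Rightarrow> 'b::real_normed_vector"
  assumes "strongly_measurable (lebesgue_on S) f" "S \<in> sets lebesgue"
  shows "(\<lambda>x. norm (f x)) \<in> borel_measurable (lebesgue_on S)"
proof -
  obtain u where u: "\<And>n::nat. simple_function (lebesgue_on S) (u n)"
      and lim: "AE x in lebesgue_on S. (\<lambda>n. u n x) \<longlonglongrightarrow> f x"
    using assms(1) unfolding strongly_measurable_def by blast
  define w where "w n x = (if x \<in> S then norm (u n x) else 0)" for n x
  have "w n \<in> borel_measurable lebesgue" for n
    unfolding w_def
    by (rule borel_measurable_if[OF assms(2), THEN iffD2])
      (rule borel_measurable_simple_function[OF simple_function_compose1[OF u]])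
  then have "(\<lambda>x. lim (\<lambda>n. w n x)) \<in> borel_measurable lebesgue"
    by (rule borel_measurable_lim_metric)
  moreover have "AE x in lebesgue. lim (\<lambda>n. w n x) = (if x \<in> S then norm (f x) else 0)"
  proof -
    have "AE x in lebesgue. x \<in> S \<longrightarrow> (\<lambda>n. u n x) \<longlonglongrightarrow> f x"
      using lim assms(2) by (subst (asm) AE_restrict_space_iff) auto
    then show ?thesis
      by eventually_elim (auto simp: w_def intro!: limI tendsto_norm)
  qed
  ultimately have "(\<lambda>x. if x \<in> S then norm (f x) else 0) \<in> borel_measurable lebesgue"
    by (rule borel_measurable_AE)
  then show ?thesis
    by (rule borel_measurable_if[OF assms(2), THEN iffD1])
qed

text \<open>
  For \<open>Re s > \<alpha>\<close> the integrand has norm at most \<open>exp (- \<alpha> t) \<parallel>f t\<parallel>\<close>, which is integrable as a product of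
  two square integrable functions and does not depend on \<open>s\<close>.
\<close>

lemma laplace_bounded:
  fixes f :: "real \<Rightarrow> 'v::{real_inner, banach} complexified"
  assumes \<alpha>: "\<alpha> > 0" and f: "f \<in> L2 (lebesgue_on {0<..})"
    and lap: "\<And>s. s \<in> half_plane \<alpha> \<Longrightarrow> has_laplace f s (F s)"
  shows "\<exists>K. \<forall>s\<in>half_plane \<alpha>. norm (F s) \<le> K"
proof -
  let ?M = "lebesgue_on {0::real<..}"
  have meas: "(\<lambda>t. norm (f t)) \<in> borel_measurable ?M"
    using f by (intro strongly_measurable_norm) (auto simp: L2_def)
  have sq: "integrable ?M (\<lambda>t. (norm (f t))\<^sup>2)"
    using f meas by (intro integrableI_nonneg) (auto simp: L2_def)
  have ex: "integrable ?M (\<lambda>t. exp (-(t * (2 * \<alpha>))))"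
  proof -
    have "set_integrable lebesgue {0<..} (\<lambda>t. exp (-(t * (2 * \<alpha>))))"
      using integrable_I0i_exp_mscale[of "2 * \<alpha>"] \<alpha> unfolding set_integrable_def
      by (subst integrable_completion) auto
    then show ?thesis
      by (simp add: set_integrable_def integrable_restrict_space)
  qed
  have "integrable ?M (\<lambda>t. exp (-(\<alpha> * t)) * norm (f t))"
  proof (rule Bochner_Integration.integrable_bound[OF Bochner_Integration.integrable_add[OF ex sq]])
    have "(\<lambda>t. exp (-(\<alpha> * t))) \<in> borel_measurable ?M"
      by (intro measurable_restrict_space1 measurable_completion) auto
    then show "(\<lambda>t. exp (-(\<alpha> * t)) * norm (f t)) \<in> borel_measurable ?M"
      using meas by (rule borel_measurable_times)
    show "AE t in ?M. norm (exp (-(\<alpha> * t)) * norm (f t)) \<le> norm (exp (-(t * (2 * \<alpha>))) + (norm (f t))\<^sup>2)"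
    proof (rule AE_I2)
      fix t :: real
      define x where "x = exp (-(\<alpha> * t))"
      define y where "y = norm (f t)"
      have "0 \<le> x" "0 \<le> y" by (auto simp: x_def y_def)
      have "exp (-(t * (2 * \<alpha>))) = x\<^sup>2"
        by (simp add: x_def power2_eq_square flip: exp_add)
      moreover have "x * y \<le> x\<^sup>2 + y\<^sup>2"
        using sum_squares_bound[of x y] \<open>0 \<le> x\<close> \<open>0 \<le> y\<close> mult_nonneg_nonneg[of x y] by linarith
      ultimately show "norm (exp (-(\<alpha> * t)) * norm (f t)) \<le> norm (exp (-(t * (2 * \<alpha>))) + (norm (f t))\<^sup>2)"
        using \<open>0 \<le> x\<close> \<open>0 \<le> y\<close> by (simp flip: x_def y_def)
    qed
  qed
  then have dom: "(\<lambda>t. exp (-(\<alpha> * t)) * norm (f t)) integrable_on {0<..}"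
    by (rule integrable_on_lebesgue_on) auto
  show ?thesis
  proof (intro exI ballI)
    fix s assume s: "s \<in> half_plane \<alpha>"
    let ?h = "\<lambda>t. cscale (exp (- s * complex_of_real t)) (f t)"
    have h: "(?h has_integral F s) {0<..}"
      using lap[OF s] by (simp add: has_laplace_def)
    have "norm (integral {0<..} ?h) \<le> integral {0<..} (\<lambda>t. exp (-(\<alpha> * t)) * norm (f t))"
    proof (rule Henstock_Kurzweil_Integration.integral_norm_bound_integral[OF _ dom])
      show "?h integrable_on {0<..}" using h by blast
      show "norm (?h t) \<le> exp (-(\<alpha> * t)) * norm (f t)" if "t \<in> {0<..}" for t
        unfolding norm_cscale
        using that s by (intro mult_right_mono) (auto simp: half_plane_def)
    qed
    then show "norm (F s) \<le> integral {0<..} (\<lambda>t. exp (-(\<alpha> * t)) * norm (f t))"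
      using h by (simp add: integral_unique)
  qed
qed

section \<open>Boundary functions\<close>

text \<open>
  On \<open>{-n..n}\<close> the function \<open>g n\<close> is uniformly continuous, so it is within \<open>1 / (n + 1)\<close> of a step function;
  these step functions have the same pointwise limit as the \<open>g n\<close>.
\<close>

lemma strongly_measurable_limit_of_continuous:
  fixes g :: "nat \<Rightarrow> real \<Rightarrow> 'b::real_normed_vector"
  assumes cont: "\<And>n. continuous_on UNIV (g n)"
    and lim: "AE x in lebesgue. (\<lambda>n. g n x) \<longlonglongrightarrow> h x"
  shows "strongly_measurable lebesgue h"
proof -
  have "\<exists>u. simple_function lebesgue u \<and> (\<forall>x\<in>{-real n..real n}. dist (u x) (g n x) < inverse (real (Suc n)))"
    for n
  proof -
    \<comment> \<open>The interval is enlarged on the left because rounding down to a multiple of \<open>e \<le> 1\<close> may leave \<open>{-n..n}\<close>.\<close>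
    have "uniformly_continuous_on {-real n - 1..real n} (g n)"
      by (intro compact_uniformly_continuous continuous_on_subset[OF cont]) auto
    then obtain d where d: "d > 0" "\<And>x y. x \<in> {-real n - 1..real n} \<Longrightarrow> y \<in> {-real n - 1..real n} \<Longrightarrow>
        dist y x < d \<Longrightarrow> dist (g n y) (g n x) < inverse (real (Suc n))"
      unfolding uniformly_continuous_on_def
      using positive_imp_inverse_positive[of "real (Suc n)"] by (metis of_nat_0_less_iff zero_less_Suc)
    define e where "e = min 1 (d / 2)"
    have e: "e > 0" "e \<le> 1" "e < d" using d(1) by (auto simp: e_def)
    define p where "p x = (if x \<in> {-real n..real n} then e * of_int \<lfloor>x / e\<rfloor> else 0)" for x :: real
    have "simple_function lebesgue p"
    proof (rule simple_function_borel_measurable)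
      show "p \<in> borel_measurable lebesgue"
        unfolding p_def by (intro measurable_completion) measurable
      have "p ` space lebesgue \<subseteq> insert 0 ((\<lambda>k. e * of_int k) ` {\<lfloor>-real n / e\<rfloor>..\<lfloor>real n / e\<rfloor>})"
      proof (rule image_subsetI)
        fix x
        have "\<lfloor>x / e\<rfloor> \<in> {\<lfloor>-real n / e\<rfloor>..\<lfloor>real n / e\<rfloor>}" if "x \<in> {-real n..real n}"
          using that e divide_right_mono[of "-real n" x e] divide_right_mono[of x "real n" e]
          by (simp add: floor_mono)
        then show "p x \<in> insert 0 ((\<lambda>k. e * of_int k) ` {\<lfloor>-real n / e\<rfloor>..\<lfloor>real n / e\<rfloor>})"
          unfolding p_def by auto
      qed
      then show "finite (p ` space lebesgue)"
        by (rule finite_subset) auto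
    qed
    then have "simple_function lebesgue (\<lambda>x. g n (p x))"
      by (rule simple_function_compose1)
    moreover have "dist (g n (p x)) (g n x) < inverse (real (Suc n))" if x: "x \<in> {-real n..real n}" for x
    proof -
      have "e * of_int \<lfloor>x / e\<rfloor> \<le> e * (x / e)" "e * (x / e) < e * (of_int \<lfloor>x / e\<rfloor> + 1)"
        using e floor_correct[of "x / e"] by (intro mult_left_mono mult_strict_left_mono; simp)+
      then have "p x \<le> x" "x < p x + e"
        using e x by (simp_all add: p_def distrib_left)
      then show ?thesis
        using e x by (intro d(2)) (auto simp: dist_real_def)
    qed
    ultimately show ?thesis by blast
  qed
  then obtain u where u: "\<And>n. simple_function lebesgue (u n)"
    "\<And>n x. x \<in> {-real n..real n} \<Longrightarrow> dist (u n x) (g n x) < inverse (real (Suc n))"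
    by metis
  have "AE x in lebesgue. (\<lambda>n. u n x) \<longlonglongrightarrow> h x"
    using lim
  proof eventually_elim
    case (elim x)
    have "(\<lambda>n. u n x - g n x) \<longlonglongrightarrow> 0"
    proof (rule Lim_null_comparison[OF _ LIMSEQ_inverse_real_of_nat])
      show "\<forall>\<^sub>F n in sequentially. norm (u n x - g n x) \<le> inverse (real (Suc n))"
        using eventually_ge_at_top[of "nat \<lceil>\<bar>x\<bar>\<rceil>"]
      proof eventually_elim
        case (elim n)
        then have "x \<in> {-real n..real n}" by auto
        then show ?case using u(2)[of x n] by (simp add: dist_norm)
      qed
    qed
    from tendsto_add[OF this elim] show ?case by simp
  qed
  then show ?thesis
    using u(1) unfolding strongly_measurable_def by blast
qed

theorem corollary3:
  fixes \<alpha> :: real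
    and F F\<alpha> :: "complex \<Rightarrow> 'v::{real_inner, banach} complexified"
    and f :: "real \<Rightarrow> 'v complexified"
  assumes "\<alpha> > 0"
    and "F \<in> hardy2 \<alpha>"
    and "f \<in> L2 (lebesgue_on {0<..})"
    and "\<And>s. s \<in> half_plane \<alpha> \<Longrightarrow> has_laplace f s (F s)"
    and "is_boundary_function \<alpha> F F\<alpha>"
  shows "F\<alpha> \<in> L2_imag_axis \<and>
    L2_norm_imag_axis F\<alpha> = sqrt 2 * L2_norm_imag_axis (\<lambda>s. Re_part (F\<alpha> s))"
proof -
  define G where "G \<tau> = F\<alpha> (\<i> * complex_of_real \<tau>)" for \<tau>
  have hol: "cvec_holomorphic_on F (half_plane \<alpha>)"
    and sup: "(SUP \<sigma>\<in>{\<alpha><..}. \<integral>\<^sup>+\<tau>. ennreal ((norm (F (Complex \<sigma> \<tau>)))\<^sup>2) \<partial>lebesgue) < \<infinity>"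
    using assms(2) by (auto simp: hardy2_def)
  have lim: "AE \<tau> in lebesgue. ((\<lambda>\<sigma>. F (Complex \<sigma> \<tau>)) \<longlongrightarrow> G \<tau>) (at_right \<alpha>)"
    using assms(5) by (simp add: is_boundary_function_def G_def)
  define \<sigma> where "\<sigma> n = \<alpha> + inverse (real (Suc n))" for n
  have \<sigma>: "\<sigma> n > \<alpha>" for n by (simp add: \<sigma>_def)
  have \<sigma>_right: "filterlim \<sigma> (at_right \<alpha>) sequentially"
    using \<sigma> LIMSEQ_inverse_real_of_nat_add[of \<alpha>]
    by (auto simp: filterlim_at \<sigma>_def[abs_def] intro!: always_eventually)
  have limn: "AE \<tau> in lebesgue. (\<lambda>n. F (Complex (\<sigma> n) \<tau>)) \<longlonglongrightarrow> G \<tau>"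
    using lim by eventually_elim (rule filterlim_compose[OF _ \<sigma>_right])
  have contF: "continuous_on (half_plane \<alpha>) F"
    using hol has_derivative_continuous
    unfolding cvec_holomorphic_on_def continuous_on_eq_continuous_within by blast
  have cont: "continuous_on UNIV (\<lambda>\<tau>. F (Complex (\<sigma> n) \<tau>))" for n
    by (rule continuous_on_compose2[OF contF])
       (use \<sigma> in \<open>auto simp: half_plane_def Complex_eq intro!: continuous_intros\<close>)
  have strong: "strongly_measurable lebesgue G"
    using cont limn by (rule strongly_measurable_limit_of_continuous)
  \<comment> \<open>Scalar continuous functions of the boundary values are measurable, even for non-separable \<open>'v\<close>.\<close>
  have meas: "(\<lambda>\<tau>. q (G \<tau>)) \<in> borel_measurable lebesgue"
    if q: "continuous_on UNIV q" for q :: "'v complexified \<Rightarrow> real"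
  proof (rule borel_measurable_AE)
    have "(\<lambda>\<tau>. q (F (Complex (\<sigma> n) \<tau>))) \<in> borel_measurable lebesgue" for n
      by (intro measurable_completion)
         (simp add: borel_measurable_continuous_onI continuous_on_compose2[OF q cont])
    then show "(\<lambda>\<tau>. lim (\<lambda>n. q (F (Complex (\<sigma> n) \<tau>)))) \<in> borel_measurable lebesgue"
      by (rule borel_measurable_lim_metric)
    show "AE \<tau> in lebesgue. lim (\<lambda>n. q (F (Complex (\<sigma> n) \<tau>))) = q (G \<tau>)"
      using limn
      by eventually_elim (auto intro!: limI continuous_on_tendsto_compose[OF q])
  qed
  \<comment> \<open>Fatou's lemma bounds the boundary function by the supremum in the Hardy space condition.\<close>
  have fin: "(\<integral>\<^sup>+\<tau>. ennreal ((norm (G \<tau>))\<^sup>2) \<partial>lebesgue) < \<infinity>"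
  proof -
    have "(\<integral>\<^sup>+\<tau>. ennreal ((norm (G \<tau>))\<^sup>2) \<partial>lebesgue)
        = (\<integral>\<^sup>+\<tau>. liminf (\<lambda>n. ennreal ((norm (F (Complex (\<sigma> n) \<tau>)))\<^sup>2)) \<partial>lebesgue)"
    proof (rule nn_integral_cong_AE)
      show "AE \<tau> in lebesgue. ennreal ((norm (G \<tau>))\<^sup>2) = liminf (\<lambda>n. ennreal ((norm (F (Complex (\<sigma> n) \<tau>)))\<^sup>2))"
        using limn
      proof eventually_elim
        case (elim \<tau>)
        have "(\<lambda>n. ennreal ((norm (F (Complex (\<sigma> n) \<tau>)))\<^sup>2)) \<longlonglongrightarrow> ennreal ((norm (G \<tau>))\<^sup>2)"
          by (intro tendsto_ennrealI tendsto_intros elim)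
        then show ?case
          by (metis lim_imp_Liminf sequentially_bot)
      qed
    qed
    also have "\<dots> \<le> liminf (\<lambda>n. \<integral>\<^sup>+\<tau>. ennreal ((norm (F (Complex (\<sigma> n) \<tau>)))\<^sup>2) \<partial>lebesgue)"
    proof (rule nn_integral_liminf)
      show "(\<lambda>\<tau>. ennreal ((norm (F (Complex (\<sigma> n) \<tau>)))\<^sup>2)) \<in> borel_measurable lebesgue" for n
        by (intro measurable_completion measurable_compose[OF _ measurable_ennreal])
           (simp add: borel_measurable_continuous_onI cont continuous_intros)
    qed
    also have "\<dots> \<le> (SUP \<sigma>\<in>{\<alpha><..}. \<integral>\<^sup>+\<tau>. ennreal ((norm (F (Complex \<sigma> \<tau>)))\<^sup>2) \<partial>lebesgue)"
      by (intro Liminf_le always_eventually allI SUP_upper) (use \<sigma> in auto)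
    finally show ?thesis
      using sup by (rule le_less_trans)
  qed
  have int: "integrable lebesgue (\<lambda>\<tau>. (norm (G \<tau>))\<^sup>2)"
    using fin by (intro integrableI_nonneg meas) (auto intro!: continuous_intros)
  have int_part: "integrable lebesgue (\<lambda>\<tau>. (norm (fst (G \<tau>)))\<^sup>2)" "integrable lebesgue (\<lambda>\<tau>. (norm (snd (G \<tau>)))\<^sup>2)"
    by (rule Bochner_Integration.integrable_bound[OF int];
        force intro!: meas continuous_intros simp: norm_complexified_power2)+
  have re: "(\<lambda>\<tau>. Re (bilinear_square (G \<tau>))) \<in> borel_measurable lebesgue"
    and im: "(\<lambda>\<tau>. Im (bilinear_square (G \<tau>))) \<in> borel_measurable lebesgue"
    unfolding bilinear_square_def complex.sel by (intro meas continuous_intros)+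
  have int_b: "integrable lebesgue (\<lambda>\<tau>. bilinear_square (G \<tau>))"
    by (rule Bochner_Integration.integrable_bound[OF int])
       (use re im in \<open>auto simp: borel_measurable_complex_iff intro!: norm_bilinear_square_le\<close>)
  obtain K where K: "\<And>s. s \<in> half_plane \<alpha> \<Longrightarrow> norm (F s) \<le> K"
    using laplace_bounded[OF assms(1,3,4)] by blast
  have "(\<integral>\<tau>. bilinear_square (G \<tau>) \<partial>lebesgue) = 0"
  proof (rule boundary_integral_eq_0[OF holomorphic_on_bilinear_square[OF hol] _ int_b])
    show "norm (bilinear_square (F s)) \<le> K\<^sup>2" if "s \<in> half_plane \<alpha>" for s
      using norm_bilinear_square_le[of "F s"] power_mono[OF K[OF that], of 2] by simp
    show "AE \<tau> in lebesgue. ((\<lambda>\<sigma>. bilinear_square (F (Complex \<sigma> \<tau>))) \<longlongrightarrow> bilinear_square (G \<tau>)) (at_right \<alpha>)"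
      using lim by eventually_elim (rule tendsto_bilinear_square)
  qed
  then have "(\<integral>\<tau>. Re (bilinear_square (G \<tau>)) \<partial>lebesgue) = 0"
    using integral_Re[OF int_b] by simp
  then have "(\<integral>\<tau>. (norm (fst (G \<tau>)))\<^sup>2 \<partial>lebesgue) = (\<integral>\<tau>. (norm (snd (G \<tau>)))\<^sup>2 \<partial>lebesgue)"
    using int_part by (simp add: bilinear_square_def)
  then have eq: "(\<integral>\<tau>. (norm (G \<tau>))\<^sup>2 \<partial>lebesgue) = 2 * (\<integral>\<tau>. (norm (fst (G \<tau>)))\<^sup>2 \<partial>lebesgue)"
    using int_part by (simp add: norm_complexified_power2)
  have L2: "L2_norm lebesgue g = sqrt (\<integral>\<tau>. (norm (g \<tau>))\<^sup>2 \<partial>lebesgue)"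
    if "integrable lebesgue (\<lambda>\<tau>. (norm (g \<tau>))\<^sup>2)" for g :: "real \<Rightarrow> 'b::real_normed_vector"
    unfolding L2_norm_def using that by (simp add: nn_integral_eq_integral)
  have "L2_norm_imag_axis F\<alpha> = sqrt 2 * L2_norm_imag_axis (\<lambda>s. Re_part (F\<alpha> s))"
    unfolding L2_norm_imag_axis_def Re_part_def G_def[symmetric]
    using L2[OF int] L2[OF int_part(1)] eq by (simp add: real_sqrt_mult)
  moreover have "F\<alpha> \<in> L2_imag_axis"
    using strong fin by (simp add: L2_imag_axis_def L2_def G_def[symmetric])
  ultimately show ?thesis by simp
qed

end
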